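(* For each integer $n\ge1$ let $r_n\subset\mathbb{R}^2$ be a rectangle whose eccentricity and orientation are $$(e_{r_n},\omega_{r_n})=\Big(\frac1n,\ \sin(n)\frac{\pi}{4}\Big)$$ (orientations being understood modulo $\pi$), and let $\mathcal{B}_e=\{r_n: n\ge1\}$. Then $M_{\mathcal{B}_e}$ is a bad operator, i.e. $M_{\mathcal{B}_e}$ is unbounded on $L^p(\mathbb{R}^2)$ for every $1<p<\infty$.
   Context: For a (non-degenerate) rectangle $r\subset\mathbb{R}^2$, its orientation $\omega_r$ is the angle (modulo $\pi$) its longest side makes with the $x$-axis, and its eccentricity $e_r\in(0,1]$ is the ratio of its shortest side to its longest side. For a non-empty family $\mathcal{B}$ of rectangles, put $\mathcal{B}^*=\{\vec t+hr:\vec t\in\mathbb{R}^2,\ h>0,\ r\in\mathcal{B}\}$ and, for $f\in L^1_{loc}(\mathbb{R}^2)$ and $x\in\mathbb{R}^2$, $$M_{\mathcal{B}}f(x)=\sup_{x\in r\in\mathcal{B}^*}\frac1{|r|}\int_r|f| ,$$ the supremum being over all $r\in\mathcal{B}^*$ containing $x$. Put $\|M_{\mathcal{B}}\|_p=\sup_{\|f\|_p=1}\|M_{\mathcal{B}}f\|_p$; $M_{\mathcal{B}}$ is bounded on $L^p(\mathbb{R}^2)$ if $\|M_{\mathcal{B}}\|_p<\infty$ and unbounded otherwise. *)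

theory Defs
  imports "HOL-Analysis.Analysis" "HOL-Library.Real_Mod"
begin

section \<open>Rectangles in the plane\<close>

text \<open>
  The closed rectangle with a corner at \<open>c\<close>, whose sides of length \<open>L\<close> are parallel to
  \<open>(cos \<theta>, sin \<theta>)\<close> and whose sides of length \<open>l\<close> are orthogonal to it.
\<close>

definition rect :: "real^2 \<Rightarrow> real \<Rightarrow> real \<Rightarrow> real \<Rightarrow> (real^2) set" where
  "rect c \<theta> L l =
     {c + s *\<^sub>R vector [cos \<theta>, sin \<theta>] + t *\<^sub>R vector [- sin \<theta>, cos \<theta>] |
        s t. 0 \<le> s \<and> s \<le> L \<and> 0 \<le> t \<and> t \<le> l}"

definition rectangle :: "(real^2) set \<Rightarrow> bool" where
  "rectangle R \<longleftrightarrow> (\<exists>c \<theta> L l. 0 < l \<and> l \<le> L \<and> R = rect c \<theta> L l)"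

definition has_eccentricity :: "(real^2) set \<Rightarrow> real \<Rightarrow> bool" where
  "has_eccentricity R e \<longleftrightarrow>
     (\<exists>c \<theta> L l. 0 < l \<and> l \<le> L \<and> R = rect c \<theta> L l \<and> e = l / L)"

text \<open>
  Orientation is a relation because a square has two classes of longest sides, hence two
  orientations modulo \<open>pi\<close>; for all other rectangles the orientation is unique modulo \<open>pi\<close>.
\<close>

definition has_orientation :: "(real^2) set \<Rightarrow> real \<Rightarrow> bool" where
  "has_orientation R \<omega> \<longleftrightarrow>
     (\<exists>c \<theta> L l. 0 < l \<and> l \<le> L \<and> R = rect c \<theta> L l \<and> [\<omega> = \<theta>] (rmod pi))"


section \<open>The maximal operator of a family\<close>

definition homothetic_copies :: "(real^2) set set \<Rightarrow> (real^2) set set" where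
  "homothetic_copies B = {(\<lambda>y. t + h *\<^sub>R y) ` R | t h R. 0 < h \<and> R \<in> B}"

definition maximal_op :: "(real^2) set set \<Rightarrow> (real^2 \<Rightarrow> real) \<Rightarrow> real^2 \<Rightarrow> ennreal" where
  "maximal_op B f x =
     (SUP R \<in> {R \<in> homothetic_copies B. x \<in> R}.
        (\<integral>\<^sup>+y\<in>R. ennreal \<bar>f y\<bar> \<partial>lebesgue) / emeasure lebesgue R)"


section \<open>Boundedness on Lebesgue spaces\<close>

text \<open>
  A maximal function may take the value \<open>\<infinity>\<close>, so norms are taken of functions with values in
  the extended nonnegative reals; this power is only used with exponents \<open>q > 0\<close>.
\<close>

definition ennpowr :: "ennreal \<Rightarrow> real \<Rightarrow> ennreal" where
  "ennpowr a q = (if a = \<infinity> then \<infinity> else ennreal (enn2real a powr q))"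

definition Lp_norm :: "real \<Rightarrow> (real^2 \<Rightarrow> ennreal) \<Rightarrow> ennreal" where
  "Lp_norm p g = ennpowr (\<integral>\<^sup>+x. ennpowr (g x) p \<partial>lebesgue) (1 / p)"

text \<open>
  Membership in \<open>L\<^sup>p\<close> is measurability together with finiteness of the norm. For \<open>p \<ge> 1\<close>
  it implies local integrability.
\<close>

definition maximal_op_norm :: "(real^2) set set \<Rightarrow> real \<Rightarrow> ennreal" where
  "maximal_op_norm B p =
     (SUP f \<in> {f \<in> borel_measurable lebesgue. Lp_norm p (\<lambda>x. ennreal \<bar>f x\<bar>) = 1}.
        Lp_norm p (maximal_op B f))"

definition bounded_on_Lp :: "(real^2) set set \<Rightarrow> real \<Rightarrow> bool" where
  "bounded_on_Lp B p \<longleftrightarrow> maximal_op_norm B p < \<infinity>"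

definition bad_operator :: "(real^2) set set \<Rightarrow> bool" where
  "bad_operator B \<longleftrightarrow> (\<forall>p. 1 < p \<longrightarrow> \<not> bounded_on_Lp B p)"

end

theory Submission
  imports Defs
begin

text \<open>
  Since \<open>pi\<close> is irrational, the numbers \<open>sin n\<close> are dense in \<open>[-1, 1]\<close>, so the homothetic copies
  contain arbitrarily thin rectangles in directions arbitrarily close to any slope \<open>a\<close> in \<open>[0, 1]\<close>.
  Consider the \<open>2 ^ k\<close> lines \<open>y = (\<Sum>i\<in>A. 2 ^ (-i) * (x - i / k))\<close> for \<open>A \<subseteq> {1..k}\<close>, thickened
  vertically to width \<open>2 ^ (-k)\<close>. For \<open>x\<close> near \<open>m / k\<close> the digits \<open>i \<ge> m\<close> contribute only
  \<open>O(2 ^ (-m) / k)\<close>, so over \<open>0 \<le> x \<le> 1\<close> the strips overlap heavily and their union has area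
  \<open>O(1 / k)\<close>; over \<open>2 \<le> x \<le> 3\<close> they are pairwise disjoint and have total area comparable to 1. A thin
  rectangle following a strip from a point of its second part back to its first part shows that
  the maximal function of the indicator of the first union is at least \<open>1 / 12\<close> on the second.
\<close>

section \<open>Density of the sines of the integers\<close>

text \<open>Integrating by parts twice leaves the boundary term \<open>F\<close>, whose derivative
  is this integrand and which vanishes at both endpoints. The outcome is a three-term recurrence for
  the moments of the weight.\<close>

lemma has_integral_cos_weight_rec:
  fixes a :: real
  shows "((\<lambda>x. a\<^sup>2 * ((1 - x\<^sup>2) ^ (n+2) * cos (a*x))
     - real (2 * (n+2) * (2*n+3)) * ((1 - x\<^sup>2) ^ (n+1) * cos (a*x))
     + real (4 * (n+2) * (n+1)) * ((1 - x\<^sup>2) ^ n * cos (a*x))) has_integral 0) {-1..1}"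
proof -
  define F where "F = (\<lambda>x::real. a * (1 - x\<^sup>2) ^ (n+2) * sin (a*x) - real (2 * (n+2)) * x * (1 - x\<^sup>2) ^ (n+1) * cos (a*x))"
  have "((\<lambda>x. a\<^sup>2 * ((1 - x\<^sup>2) ^ (n+2) * cos (a*x))
     - real (2 * (n+2) * (2*n+3)) * ((1 - x\<^sup>2) ^ (n+1) * cos (a*x))
     + real (4 * (n+2) * (n+1)) * ((1 - x\<^sup>2) ^ n * cos (a*x))) has_integral (F 1 - F (-1))) {-1..1}"
  proof (rule fundamental_theorem_of_calculus)
    fix x :: real assume "x \<in> {-1..1}"
    show "(F has_vector_derivative (a\<^sup>2 * ((1 - x\<^sup>2) ^ (n+2) * cos (a*x))
     - real (2 * (n+2) * (2*n+3)) * ((1 - x\<^sup>2) ^ (n+1) * cos (a*x))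
     + real (4 * (n+2) * (n+1)) * ((1 - x\<^sup>2) ^ n * cos (a*x)))) (at x within {-1..1})"
      unfolding F_def has_real_derivative_iff_has_vector_derivative[symmetric]
      apply (rule derivative_eq_intros refl | simp)+
      apply (simp add: algebra_simps power2_eq_square)
      done
  qed simp
  then show ?thesis by (simp add: F_def)
qed

text \<open>
  Cartwright's argument: with \<open>pi / 2 = p / q\<close>, suitably scaled moments \<open>K n\<close> of \<open>(1 - x\<^sup>2) ^ n * cos (pi x / 2)\<close>
  satisfy a recurrence with integer coefficients, so they are positive integers, yet they tend to 0.
\<close>

lemma pi_irrational: "pi \<notin> \<rat>"
proof
  assume "pi \<in> \<rat>"
  then have "pi / 2 \<in> \<rat>" by simp
  then obtain p q where q: "q > 0" and pq: "pi / 2 = of_int p / of_int q"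
    by (metis Rats_cases')
  define a where "a = pi / 2"
  have a0: "a > 0" by (simp add: a_def)
  have aq: "a * of_int q = of_int p" using pq q by (simp add: a_def field_simps)
  define I where "I n = integral {-1..1} (\<lambda>x::real. (1 - x\<^sup>2) ^ n * cos (a*x))" for n
  have hi: "((\<lambda>x::real. (1 - x\<^sup>2) ^ n * cos (a*x)) has_integral I n) {-1..1}" for n
    unfolding I_def by (intro integrable_integral integrable_continuous_real continuous_intros)
  have rec: "a\<^sup>2 * I (n+2) = real (2 * (n+2) * (2*n+3)) * I (n+1) - real (4 * (n+2) * (n+1)) * I n" for n
  proof -
    have "((\<lambda>x. a\<^sup>2 * ((1 - x\<^sup>2) ^ (n+2) * cos (a*x))
     - real (2 * (n+2) * (2*n+3)) * ((1 - x\<^sup>2) ^ (n+1) * cos (a*x))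
     + real (4 * (n+2) * (n+1)) * ((1 - x\<^sup>2) ^ n * cos (a*x))) has_integral
       (a\<^sup>2 * I (n+2) - real (2 * (n+2) * (2*n+3)) * I (n+1) + real (4 * (n+2) * (n+1)) * I n)) {-1..1}"
      by (intro has_integral_add has_integral_diff has_integral_mult_right hi)
    from has_integral_unique[OF this has_integral_cos_weight_rec]
    show ?thesis by simp
  qed
  have I0: "I 0 = 2 / a"
  proof -
    have "((\<lambda>x. cos (a*x)) has_integral (sin (a*1) / a - sin (a*(-1)) / a)) {-1..1}"
      using a0 by (intro fundamental_theorem_of_calculus)
        (auto simp: has_real_derivative_iff_has_vector_derivative[symmetric] intro!: derivative_eq_intros)
    then have "((\<lambda>x. (1 - x\<^sup>2) ^ 0 * cos (a*x)) has_integral (2 / a)) {-1..1}"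
      using a0 by (simp add: a_def)
    with hi[of 0] show ?thesis by (rule has_integral_unique)
  qed
  have I1: "a\<^sup>2 * I 1 = 4 / a"
  proof -
    have "((\<lambda>x. a\<^sup>2 * ((1 - x\<^sup>2) ^ 1 * cos (a*x)) - 2 * ((1 - x\<^sup>2) ^ 0 * cos (a*x)))
       has_integral ((a * (1 - 1\<^sup>2) * sin (a*1) - 2 * 1 * cos (a*1))
         - (a * (1 - (-1)\<^sup>2) * sin (a*(-1)) - 2 * (-1) * cos (a*(-1))))) {-1..1}"
      by (intro fundamental_theorem_of_calculus)
        (auto simp: has_real_derivative_iff_has_vector_derivative[symmetric] power2_eq_square algebra_simps
          intro!: derivative_eq_intros)
    moreover have "((\<lambda>x. a\<^sup>2 * ((1 - x\<^sup>2) ^ 1 * cos (a*x)) - 2 * ((1 - x\<^sup>2) ^ 0 * cos (a*x)))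
       has_integral (a\<^sup>2 * I 1 - 2 * I 0)) {-1..1}"
      by (intro has_integral_diff has_integral_mult_right hi)
    ultimately have "a\<^sup>2 * I 1 - 2 * I 0 = ((a * (1 - 1\<^sup>2) * sin (a*1) - 2 * 1 * cos (a*1))
         - (a * (1 - (-1)\<^sup>2) * sin (a*(-1)) - 2 * (-1) * cos (a*(-1))))"
      by (intro has_integral_unique)
    then have "a\<^sup>2 * I 1 - 2 * I 0 = 0" by (simp add: a_def)
    with I0 show ?thesis by simp
  qed
  have I_le: "I n \<le> 2" for n
  proof -
    have "(1 - x\<^sup>2) ^ n * cos (a*x) \<le> 1" if "x \<in> {-1..1}" for x :: real
    proof -
      have "\<bar>1 - x\<^sup>2\<bar> \<le> 1" using that by (simp add: abs_square_le_1 abs_le_iff)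
      then have "\<bar>(1 - x\<^sup>2) ^ n * cos (a*x)\<bar> \<le> 1 * 1"
        unfolding abs_mult by (intro mult_mono) (auto simp: power_abs power_le_one)
      then show ?thesis by linarith
    qed
    from has_integral_le[OF hi[of n] has_integral_const_real this] show ?thesis by simp
  qed
  have I_pos: "I n > 0" for n
  proof -
    have cos_pos: "cos (a*x) \<ge> 0" if "x \<in> {-1..1}" for x
    proof -
      have "\<bar>a * x\<bar> \<le> a" using that a0 by (simp add: abs_mult abs_le_iff mult_left_le)
      then have "- (pi / 2) \<le> a * x" "a * x \<le> pi / 2" using a_def by linarith+
      then show ?thesis by (rule cos_ge_zero)
    qed
    have *: "0 \<le> (1 - x\<^sup>2) ^ n * cos (a*x)" if "x \<in> {-1..1}" for x :: real
      using that cos_pos[OF that] by (intro mult_nonneg_nonneg zero_le_power) (auto simp: abs_square_le_1 abs_le_iff)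
    have "I n \<ge> 0" by (rule has_integral_nonneg[OF hi *])
    moreover have "I n \<noteq> 0"
    proof
      \<comment> \<open>A continuous non-negative integrand with integral 0 would vanish
        identically, but this one is 1 at the origin.\<close>
      assume "I n = 0"
      then have "((\<lambda>x::real. (1 - x\<^sup>2) ^ n * cos (a*x)) has_integral 0) (cbox (-1) 1)" using hi[of n] by simp
      then have "(1 - 0\<^sup>2) ^ n * cos (a*0) = 0"
        by (rule has_integral_0_cbox_imp_0[rotated 2]) (use * in \<open>auto intro!: continuous_intros simp: box_real\<close>)
      then show False by simp
    qed
    ultimately show ?thesis by simp
  qed
  \<comment> \<open>The powers of \<open>a\<close> absorb the \<open>a\<^sup>2\<close> on the left
    of the recurrence and the \<open>1 / a\<close> in \<open>I 0\<close>, the factorial cancels the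
    factors \<open>n + 1\<close> and \<open>n + 2\<close>, and the powers of \<open>q\<close> turn
    the remaining \<open>a\<close> into the integer \<open>p\<close>.\<close>
  define K where "K n = of_int q ^ (2*n) * a ^ (2*n+1) * I n / fact n" for n
  have Krec: "K (n+2) = 2 * real (2*n+3) * (of_int q)\<^sup>2 * K (n+1) - 4 * (of_int p)\<^sup>2 * (of_int q)\<^sup>2 * K n" for n
  proof -
    define X where "X = of_int q ^ (2*n) * a ^ (2*n+1) / fact n"
    have k0: "K n = X * I n" by (simp add: K_def X_def)
    have k1: "K (n+1) = X * (of_int q)\<^sup>2 * a\<^sup>2 * I (n+1) / (n+1)"
      by (simp add: K_def X_def power2_eq_square field_simps)
    have f2: "(fact (n+2) :: real) = fact n * (n+1) * (n+2)"
      by (simp add: algebra_simps)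
    have "K (n+2) = X * (of_int q)^4 * a\<^sup>2 * (a\<^sup>2 * I (n+2)) / ((n+1) * (n+2))"
      unfolding K_def X_def f2 by (simp add: power2_eq_square power4_eq_xxxx power_add algebra_simps)
    also have "\<dots> = X * (of_int q)^4 * a\<^sup>2 * (2 * (2*n+3) * I (n+1) / (n+1) - 4 * I n)"
    proof -
      have gen: "X * (of_int q)^4 * a\<^sup>2 * (2 * m * r * i - 4 * m * l * j) / (l * m)
          = X * (of_int q)^4 * a\<^sup>2 * (2 * r * i / l - 4 * j)" if "l > 0" "m > 0" for l m r i j :: real
        using that by (simp add: field_simps)
      show ?thesis unfolding rec of_nat_mult of_nat_numeral by (rule gen) simp_all
    qed
    also have "\<dots> = 2 * real (2*n+3) * (of_int q)\<^sup>2 * K (n+1) - 4 * (a * of_int q)\<^sup>2 * (of_int q)\<^sup>2 * K n"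
      unfolding k0 k1 by (simp add: field_simps power2_eq_square power4_eq_xxxx)
    finally show ?thesis unfolding aq .
  qed
  have K01: "K 0 = 2" "K 1 = 4 * (of_int q)\<^sup>2"
    using I0 I1 a0 by (simp_all add: K_def power3_eq_cube power2_eq_square field_simps)
  have Kint: "K n \<in> \<int> \<and> K (n+1) \<in> \<int>" for n
  proof (induction n)
    case 0 show ?case using K01 by simp
  next
    case (Suc n)
    then show ?case using Krec[of n] by (auto intro!: Ints_diff Ints_mult simp del: of_nat_add)
  qed
  have Kpos: "K n > 0" for n
    unfolding K_def using q a0 I_pos[of n] by simp
  have Kle: "K n \<le> 2 * a * (((of_int p)\<^sup>2) ^ n / fact n)" for n
  proof -
    have "K n = a * (((of_int p)\<^sup>2) ^ n / fact n) * I n"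
      unfolding K_def aq[symmetric] by (simp add: power_mult[symmetric] power_mult_distrib field_simps)
    also have "\<dots> \<le> a * (((of_int p)\<^sup>2) ^ n / fact n) * 2"
      using I_le[of n] a0 by (intro mult_left_mono) auto
    finally show ?thesis by (simp add: mult_ac)
  qed
  have "(\<lambda>n. (of_int p)\<^sup>2 ^ n / fact n :: real) \<longlonglongrightarrow> 0"
    using summable_LIMSEQ_zero[OF summable_exp[of "(of_int p)\<^sup>2 :: real"]] by (simp add: field_simps)
  then have "(\<lambda>n. 2 * a * (((of_int p)\<^sup>2) ^ n / fact n)) \<longlonglongrightarrow> 2 * a * 0"
    by (intro tendsto_intros)
  then have "eventually (\<lambda>n. 2 * a * (((of_int p)\<^sup>2) ^ n / fact n) < 1) sequentially"
    by (rule order_tendstoD) simp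
  then obtain n where "2 * a * (((of_int p)\<^sup>2) ^ n / fact n) < 1"
    by (auto simp: eventually_sequentially)
  then have "K n < 1" using Kle[of n] by linarith
  moreover obtain m where "K n = of_int m" using Kint[of n] by (auto elim: Ints_cases)
  ultimately show False using Kpos[of n] by auto
qed

section \<open>Integers modulo \<open>2 * pi\<close> and their sines\<close>

lemma abs_sin_diff_le: "\<bar>sin x - sin y\<bar> \<le> \<bar>x - y\<bar>" for x y :: real
proof -
  have "\<bar>sin x - sin y\<bar> = 2 * \<bar>sin ((x - y) / 2)\<bar> * \<bar>cos ((x + y) / 2)\<bar>"
    by (simp add: sin_diff_sin abs_mult)
  also have "\<dots> \<le> 2 * \<bar>(x - y) / 2\<bar> * 1"
    by (intro mult_mono abs_sin_x_le_abs_x) auto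
  finally show ?thesis by simp
qed

text \<open>By irrationality the integers are dense modulo \<open>2 * pi\<close>, so some integer
  lies near \<open>arcsin z\<close> up to full turns, and \<open>sin\<close> is 1-Lipschitz. The
  lower bound \<open>N\<close> will force a small eccentricity at the same time.\<close>

lemma sin_nat_dense:
  fixes z \<delta> :: real
  assumes "\<bar>z\<bar> \<le> 1" "\<delta> > 0"
  obtains n where "n \<ge> N" "\<bar>sin (real n) - z\<bar> < \<delta>"
proof -
  have irr: "1 / (2 * pi) \<notin> \<rat>"
  proof
    assume "1 / (2 * pi) \<in> \<rat>"
    then have "1 / (1 / (2 * pi)) / 2 \<in> \<rat>" by (rule Rats_divide[OF Rats_divide[OF Rats_1]]) simp
    then show False using pi_irrational by simp
  qed
  \<comment> \<open>The target is \<open>arcsin z - N\<close>, measured in full turns; adding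
    \<open>N\<close> back to the positive \<open>k\<close> gives \<open>n \<ge> N\<close>.\<close>
  obtain h k where k: "k > 0" and
    hk: "\<bar>of_int k * (1 / (2*pi)) - of_int h - (arcsin z / (2*pi) - of_nat N * (1 / (2*pi)))\<bar> < \<delta> / (2*pi)"
    using sequence_of_fractional_parts_is_dense[OF irr, of "\<delta> / (2*pi)"] assms by (metis divide_pos_pos pi_gt_zero zero_less_mult_iff zero_less_numeral)
  define n where "n = nat k + N"
  have "\<bar>of_int k * (1 / (2*pi)) - of_int h - (arcsin z / (2*pi) - of_nat N * (1 / (2*pi)))\<bar>
     = \<bar>(real n - 2 * pi * of_int h) - arcsin z\<bar> / (2*pi)"
  proof -
    have "of_int k * (1 / (2*pi)) - of_int h - (arcsin z / (2*pi) - of_nat N * (1 / (2*pi)))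
     = ((real n - 2 * pi * of_int h) - arcsin z) / (2*pi)"
      using k by (simp add: n_def field_simps)
    then show ?thesis by simp
  qed
  with hk have near: "\<bar>(real n - 2 * pi * of_int h) - arcsin z\<bar> < \<delta>"
    by (simp add: divide_less_cancel)
  have "\<bar>sin (real n - 2 * pi * of_int h) - sin (arcsin z)\<bar> \<le> \<bar>(real n - 2 * pi * of_int h) - arcsin z\<bar>"
    by (rule abs_sin_diff_le)
  moreover have "sin (real n - 2 * pi * of_int h) = sin (real n)"
    by (simp add: sin_diff)
  moreover have "sin (arcsin z) = z" using assms by (intro sin_arcsin) auto
  ultimately have "\<bar>sin (real n) - z\<bar> < \<delta>" using near by simp
  with that[of n] show ?thesis by (simp add: n_def)
qed

section \<open>Rectangles and strips\<close>

text \<open>A parallelogram is a translated linear image of a box, and the determinant of the map is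
  the area factor. Rectangles and slanted strips are both instances.\<close>

lemma parallelogram_measure:
  fixes c v w :: "real^2"
  assumes "0 \<le> L" "0 \<le> l"
  defines "P \<equiv> {c + s *\<^sub>R v + t *\<^sub>R w | s t. 0 \<le> s \<and> s \<le> L \<and> 0 \<le> t \<and> t \<le> l}"
  shows parallelogram_lmeasurable: "P \<in> lmeasurable"
    and measure_parallelogram: "measure lebesgue P = \<bar>v$1 * w$2 - w$1 * v$2\<bar> * (L * l)"
proof -
  define f where "f = (\<lambda>x::real^2. x$1 *\<^sub>R v + x$2 *\<^sub>R w)"
  define Q where "Q = cbox 0 (vector [L, l] :: real^2)"
  have lin: "linear f"
    unfolding f_def by (intro linearI) (auto simp: algebra_simps scaleR_add_left)
  have P: "P = (+) c ` (f ` Q)"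
  proof (intro subset_antisym subsetI)
    fix x assume "x \<in> P"
    then obtain s t where x: "x = c + s *\<^sub>R v + t *\<^sub>R w" "0 \<le> s" "s \<le> L" "0 \<le> t" "t \<le> l"
      unfolding P_def by auto
    then have "x = c + f (vector [s, t])" "vector [s, t] \<in> Q"
      by (auto simp: f_def Q_def mem_box_cart forall_2)
    then show "x \<in> (+) c ` (f ` Q)" by blast
  next
    fix x assume "x \<in> (+) c ` (f ` Q)"
    then obtain y where y: "y \<in> Q" "x = c + f y" by auto
    from y(1) have "0 \<le> y$1" "y$1 \<le> L" "0 \<le> y$2" "y$2 \<le> l"
      by (auto simp: Q_def mem_box_cart forall_2)
    with y(2) show "x \<in> P" unfolding P_def f_def by (auto simp: add.assoc)
  qed
  have det: "det (matrix f) = v$1 * w$2 - w$1 * v$2"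
    by (simp add: det_2 matrix_def f_def axis_def)
  have "Q \<noteq> {}" using assms by (auto simp: Q_def interval_ne_empty_cart forall_2)
  then have mQ: "measure lebesgue Q = L * l"
    unfolding Q_def by (simp add: content_cbox_cart UNIV_2 prod.insert)
  have fQ: "f ` Q \<in> lmeasurable" unfolding Q_def
    by (intro measurable_linear_image lin lmeasurable_cbox)
  show "P \<in> lmeasurable" unfolding P using fQ by (rule measurable_translation)
  show "measure lebesgue P = \<bar>v$1 * w$2 - w$1 * v$2\<bar> * (L * l)"
    using measure_linear_image[OF lin, of Q] by (simp add: P measure_translation det mQ) (simp add: Q_def)
qed

text \<open>Thickening a segment vertically rather than orthogonally makes the area independent of
  the slope \<open>a\<close> and reduces membership to bounds on the intercept
  \<open>x$2 - a * x$1\<close>.\<close>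

definition strip :: "real \<Rightarrow> real \<Rightarrow> real \<Rightarrow> real \<Rightarrow> real \<Rightarrow> (real^2) set" where
  "strip p q a c d = {x. p \<le> x$1 \<and> x$1 \<le> q \<and> c \<le> x$2 - a * x$1 \<and> x$2 - a * x$1 \<le> d}"

lemma strip_measure:
  assumes "p \<le> q" "c \<le> d"
  shows strip_lmeasurable: "strip p q a c d \<in> lmeasurable"
    and measure_strip: "measure lebesgue (strip p q a c d) = (q - p) * (d - c)"
proof -
  have eq: "strip p q a c d = {vector [p, a * p + c] + s *\<^sub>R vector [1, a] + t *\<^sub>R vector [0, 1] |
     s t. 0 \<le> s \<and> s \<le> q - p \<and> 0 \<le> t \<and> t \<le> d - c}" (is "_ = ?P")
  proof (intro subset_antisym subsetI)
    fix x assume x: "x \<in> strip p q a c d"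
    have "x = vector [p, a * p + c] + (x$1 - p) *\<^sub>R vector [1, a] + (x$2 - a * x$1 - c) *\<^sub>R vector [0, 1]"
      by (simp add: vec_eq_iff forall_2 algebra_simps)
    then show "x \<in> ?P" using x unfolding strip_def by fastforce
  qed (auto simp: strip_def algebra_simps)
  show "strip p q a c d \<in> lmeasurable"
    unfolding eq using assms by (intro parallelogram_lmeasurable) auto
  show "measure lebesgue (strip p q a c d) = (q - p) * (d - c)"
    unfolding eq using assms by (subst measure_parallelogram) auto
qed

lemma rect_measure:
  assumes "0 \<le> L" "0 \<le> l"
  shows rect_lmeasurable: "rect c \<theta> L l \<in> lmeasurable"
    and measure_rect: "measure lebesgue (rect c \<theta> L l) = L * l"
proof -
  show "rect c \<theta> L l \<in> lmeasurable"
    unfolding rect_def using assms by (rule parallelogram_lmeasurable)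
  have "cos \<theta> * cos \<theta> + sin \<theta> * sin \<theta> = 1"
    using sin_cos_squared_add[of \<theta>] by (simp add: power2_eq_square)
  then show "measure lebesgue (rect c \<theta> L l) = L * l"
    unfolding rect_def using assms by (subst measure_parallelogram) auto
qed

section \<open>Different parametrisations of one rectangle\<close>

lemma norm_direction: "norm (vector [cos \<theta>, sin \<theta>] :: real^2) = 1" "norm (vector [- sin \<theta>, cos \<theta>] :: real^2) = 1"
  by (simp_all add: norm_vec_def L2_set_def UNIV_2)

lemma dist_rect_le:
  assumes "x \<in> rect c \<theta> L l" "y \<in> rect c \<theta> L l"
  shows "dist x y \<le> L + l"
proof -
  let ?u = "vector [cos \<theta>, sin \<theta>] :: real^2" and ?v = "vector [- sin \<theta>, cos \<theta>] :: real^2"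
  obtain s t s' t' where
    st: "x = c + s *\<^sub>R ?u + t *\<^sub>R ?v" "0 \<le> s" "s \<le> L" "0 \<le> t" "t \<le> l" and
    st': "y = c + s' *\<^sub>R ?u + t' *\<^sub>R ?v" "0 \<le> s'" "s' \<le> L" "0 \<le> t'" "t' \<le> l"
    using assms unfolding rect_def by auto
  have "x - y = (s - s') *\<^sub>R ?u + (t - t') *\<^sub>R ?v"
    unfolding st st' by (simp add: algebra_simps)
  then have "dist x y \<le> norm ((s - s') *\<^sub>R ?u) + norm ((t - t') *\<^sub>R ?v)"
    unfolding dist_norm by (metis norm_triangle_ineq)
  also have "\<dots> = \<bar>s - s'\<bar> + \<bar>t - t'\<bar>" by (simp add: norm_direction)
  also have "\<dots> \<le> L + l" using st st' by linarith
  finally show ?thesis .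
qed

text \<open>Eccentricity and orientation are witnessed by separate parametrisations, so these must
  be compared. The areas agree, and the diameter bound gives
  \<open>L \<le> L' + l' \<le> 2 * L'\<close>; a loss of a factor 4 is harmless because the
  eccentricities tend to 0.\<close>

lemma rect_eq_imp_eccentricity_le:
  assumes "rect c \<theta> L l = rect c' \<theta>' L' l'" "0 < l" "l \<le> L" "0 < l'" "l' \<le> L'"
  shows "l' / L' \<le> 4 * (l / L)"
proof -
  have area: "L * l = L' * l'"
    using measure_rect[of L l c \<theta>] measure_rect[of L' l' c' \<theta>'] assms by simp
  let ?u = "vector [cos \<theta>, sin \<theta>] :: real^2" and ?v = "vector [- sin \<theta>, cos \<theta>] :: real^2"
  have "c = c + 0 *\<^sub>R ?u + 0 *\<^sub>R ?v" "c + L *\<^sub>R ?u = c + L *\<^sub>R ?u + 0 *\<^sub>R ?v" by simp_all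
  then have "c \<in> rect c \<theta> L l" "c + L *\<^sub>R ?u \<in> rect c \<theta> L l"
    unfolding rect_def using assms(2,3) by fastforce+
  then have "dist (c + L *\<^sub>R ?u) c \<le> L' + l'" unfolding assms(1) by (intro dist_rect_le)
  then have "L \<le> 2 * L'" using assms by (simp add: dist_norm norm_direction)
  then have "L * L \<le> (2 * L') * (2 * L')" using assms by (intro mult_mono) auto
  have "l' * L * L \<le> 4 * (l' * L') * L'"
    using mult_left_mono[OF \<open>L * L \<le> _\<close>, of l'] assms by (simp add: algebra_simps)
  also have "\<dots> = 4 * (L * l) * L'" using area by (simp add: algebra_simps)
  finally have "l' * L \<le> 4 * l * L'" using assms by simp
  then show ?thesis using assms by (simp add: field_simps)
qed

text \<open>A half turn reverses both side directions, which describes the same rectangle from the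
  opposite corner \<open>c'\<close>. Hence the given representative modulo \<open>pi\<close> can
  itself serve as the angle.\<close>

lemma has_orientation_rect:
  assumes "has_orientation R \<omega>"
  obtains c L l where "0 < l" "l \<le> L" "R = rect c \<omega> L l"
proof -
  obtain c \<theta> L l where R: "0 < l" "l \<le> L" "R = rect c \<theta> L l" and "[\<omega> = \<theta>] (rmod pi)"
    using assms unfolding has_orientation_def by auto
  then obtain n where n: "\<theta> = \<omega> + of_int n * pi" unfolding rcong_altdef by auto
  show ?thesis
  proof (cases "even n")
    case True
    then obtain m where "\<theta> = \<omega> + 2 * pi * of_int m" unfolding n by (auto elim!: evenE)
    then have "cos \<theta> = cos \<omega>" "sin \<theta> = sin \<omega>"
      by (simp_all add: cos_add sin_add)
    then show ?thesis using that R unfolding rect_def by simp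
  next
    case False
    then obtain m where "\<theta> = (\<omega> + 2 * pi * of_int m) + pi" unfolding n by (auto elim!: oddE simp: algebra_simps)
    then have cs: "cos \<theta> = - cos \<omega>" "sin \<theta> = - sin \<omega>"
      by (simp_all add: cos_add sin_add)
    let ?u = "vector [cos \<omega>, sin \<omega>] :: real^2" and ?v = "vector [- sin \<omega>, cos \<omega>] :: real^2"
    define c' where "c' = c - L *\<^sub>R ?u - l *\<^sub>R ?v"
    have neg: "vector [cos \<theta>, sin \<theta>] = - ?u" "vector [- sin \<theta>, cos \<theta>] = - ?v"
      by (simp_all add: vec_eq_iff forall_2 cs)
    have "c + s *\<^sub>R (- ?u) + t *\<^sub>R (- ?v) = c' + (L - s) *\<^sub>R ?u + (l - t) *\<^sub>R ?v" for s t
      by (simp add: c'_def algebra_simps)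
    then have "R = {c' + (L - s) *\<^sub>R ?u + (l - t) *\<^sub>R ?v | s t. 0 \<le> s \<and> s \<le> L \<and> 0 \<le> t \<and> t \<le> l}"
      unfolding R rect_def neg by simp
    also have "\<dots> = rect c' \<omega> L l"
    proof (intro subset_antisym subsetI)
      fix x assume "x \<in> rect c' \<omega> L l"
      then obtain s t where "x = c' + (L - (L - s)) *\<^sub>R ?u + (l - (l - t)) *\<^sub>R ?v"
        "0 \<le> L - s \<and> L - s \<le> L \<and> 0 \<le> l - t \<and> l - t \<le> l" unfolding rect_def by auto
      then show "x \<in> {c' + (L - s) *\<^sub>R ?u + (l - t) *\<^sub>R ?v | s t. 0 \<le> s \<and> s \<le> L \<and> 0 \<le> t \<and> t \<le> l}"
        by blast
    next
      fix x assume "x \<in> {c' + (L - s) *\<^sub>R ?u + (l - t) *\<^sub>R ?v | s t. 0 \<le> s \<and> s \<le> L \<and> 0 \<le> t \<and> t \<le> l}"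
      then obtain s t where "x = c' + (L - s) *\<^sub>R ?u + (l - t) *\<^sub>R ?v"
        "0 \<le> L - s \<and> L - s \<le> L \<and> 0 \<le> l - t \<and> l - t \<le> l" by auto
      then show "x \<in> rect c' \<omega> L l" unfolding rect_def by blast
    qed
    finally show ?thesis using that R by simp
  qed
qed

lemma image_homothety_rect:
  assumes "h > 0"
  shows "(\<lambda>y. t + h *\<^sub>R y) ` rect c \<theta> L l = rect (t + h *\<^sub>R c) \<theta> (h * L) (h * l)"
proof (intro subset_antisym subsetI)
  fix x assume "x \<in> (\<lambda>y. t + h *\<^sub>R y) ` rect c \<theta> L l"
  then obtain s r where "x = t + h *\<^sub>R (c + s *\<^sub>R vector [cos \<theta>, sin \<theta>] + r *\<^sub>R vector [- sin \<theta>, cos \<theta>])"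
    "0 \<le> s" "s \<le> L" "0 \<le> r" "r \<le> l"
    unfolding rect_def by auto
  then have "x = (t + h *\<^sub>R c) + (h * s) *\<^sub>R vector [cos \<theta>, sin \<theta>] + (h * r) *\<^sub>R vector [- sin \<theta>, cos \<theta>]"
    "0 \<le> h * s \<and> h * s \<le> h * L \<and> 0 \<le> h * r \<and> h * r \<le> h * l"
    using assms by (auto simp: algebra_simps)
  then show "x \<in> rect (t + h *\<^sub>R c) \<theta> (h * L) (h * l)" unfolding rect_def by blast
next
  fix x assume "x \<in> rect (t + h *\<^sub>R c) \<theta> (h * L) (h * l)"
  then obtain s r where x: "x = (t + h *\<^sub>R c) + s *\<^sub>R vector [cos \<theta>, sin \<theta>] + r *\<^sub>R vector [- sin \<theta>, cos \<theta>]"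
    and "0 \<le> s" "s \<le> h * L" "0 \<le> r" "r \<le> h * l"
    unfolding rect_def by auto
  then have "0 \<le> s / h \<and> s / h \<le> L \<and> 0 \<le> r / h \<and> r / h \<le> l"
    using assms by (auto simp: field_simps)
  moreover have "x = t + h *\<^sub>R (c + (s / h) *\<^sub>R vector [cos \<theta>, sin \<theta>] + (r / h) *\<^sub>R vector [- sin \<theta>, cos \<theta>])"
    using assms unfolding x by (simp add: algebra_simps)
  ultimately show "x \<in> (\<lambda>y. t + h *\<^sub>R y) ` rect c \<theta> L l"
    unfolding rect_def by blast
qed

lemma rect_homothetic_copies:
  assumes "rect c \<theta> L l \<in> B" "0 < L" "0 < M"
  shows "rect c' \<theta> M (M * (l / L)) \<in> homothetic_copies B"
proof -
  have "(\<lambda>y. (c' - (M / L) *\<^sub>R c) + (M / L) *\<^sub>R y) ` rect c \<theta> L l = rect c' \<theta> M (M * (l / L))"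
    using assms by (subst image_homothety_rect) auto
  moreover have "(\<lambda>y. (c' - (M / L) *\<^sub>R c) + (M / L) *\<^sub>R y) ` rect c \<theta> L l \<in> homothetic_copies B"
    unfolding homothetic_copies_def using assms by fastforce
  ultimately show ?thesis by simp
qed

section \<open>Lower bounds for the maximal operator\<close>

text \<open>The average over the single rectangle \<open>R\<close> is at least \<open>h\<close>
  times the proportion of \<open>R\<close> filled by \<open>S\<close>. The height \<open>h\<close>
  is kept for the later normalisation of the indicator.\<close>

lemma maximal_op_indicator_ge:
  assumes "R \<in> homothetic_copies B" "x \<in> R" "R \<in> lmeasurable" "measure lebesgue R > 0"
    and "S \<in> lmeasurable" "S \<subseteq> R \<inter> U" "0 \<le> h"
  shows "ennreal (h * (measure lebesgue S / measure lebesgue R)) \<le> maximal_op B (\<lambda>y. h * indicator U y) x"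
proof -
  have "ennreal (h * (measure lebesgue S / measure lebesgue R)) = ennreal h * emeasure lebesgue S / emeasure lebesgue R"
    using assms by (simp add: emeasure_eq_measure2 fmeasurableD2 divide_ennreal ennreal_mult[symmetric])
  moreover have "ennreal h * emeasure lebesgue S = (\<integral>\<^sup>+y. ennreal h * indicator S y \<partial>lebesgue)"
    using assms by (simp add: fmeasurableD nn_integral_cmult_indicator)
  moreover have "\<dots> \<le> (\<integral>\<^sup>+y\<in>R. ennreal \<bar>h * indicator U y\<bar> \<partial>lebesgue)"
    using assms by (intro nn_integral_mono) (auto simp: indicator_def)
  ultimately show ?thesis unfolding maximal_op_def
    using assms by (intro SUP_upper2[of R]) (auto intro: divide_right_mono_ennreal)
qed

text \<open>
  Length 6 suffices because a segment of slope near \<open>[0, 1]\<close> covering abscissae from at most 3 down to 0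
  has length at most \<open>3 / cos \<omega> < 5\<close>.
\<close>

definition thin_rects :: "(real^2) set set \<Rightarrow> bool" where
  "thin_rects B \<longleftrightarrow> (\<forall>a \<delta>. 0 \<le> a \<longrightarrow> a \<le> 1 \<longrightarrow> 0 < \<delta> \<longrightarrow>
     (\<exists>\<omega> l. \<bar>sin \<omega> - a * cos \<omega>\<bar> < \<delta> \<and> 7 / 10 \<le> cos \<omega> \<and> 0 < l \<and> l < \<delta> \<and>
       (\<forall>c. rect c \<omega> 6 l \<in> homothetic_copies B)))"

text \<open>A thin rectangle of length 6 ending at \<open>P\<close> is laid back along the strip.
  Its piece of length 1/2 lying over abscissae in \<open>[0, 1]\<close> stays inside the strip,
  which gives the proportion \<open>(1/2) / 6 = 1/12\<close>.\<close>

lemma maximal_op_strip_ge: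
  fixes P :: "real^2"
  assumes B: "thin_rects B" and a: "0 \<le> a" "a \<le> 1"
    and P: "2 \<le> P$1" "P$1 \<le> 3" "c < P$2 - a * P$1" "P$2 - a * P$1 < d"
    and U: "strip 0 1 a c d \<subseteq> U" and h: "0 \<le> h"
  shows "ennreal (h * (1/12)) \<le> maximal_op B (\<lambda>y. h * indicator U y) P"
proof -
  \<comment> \<open>\<open>\<gamma>\<close> is the vertical distance from \<open>P\<close> to the
    edges of the strip. Of the budget \<open>8 * \<delta>\<close>, the slope error over length at
    most 6 uses \<open>6 * \<delta>\<close> and the thickness \<open>2 * \<delta>\<close>; the bound
    1/100 keeps the abscissae within \<open>[0, 1]\<close>.\<close>
  define \<gamma> where "\<gamma> = min (P$2 - a * P$1 - c) (d - (P$2 - a * P$1))"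
  define \<delta> where "\<delta> = min (\<gamma> / 8) (1 / 100)"
  have "\<gamma> > 0" using P by (simp add: \<gamma>_def)
  then have \<delta>: "\<delta> > 0" "8 * \<delta> \<le> \<gamma>" "\<delta> \<le> 1 / 100" by (simp_all add: \<delta>_def min_def)
  from B a \<delta>(1) obtain \<omega> l where \<omega>: "\<bar>sin \<omega> - a * cos \<omega>\<bar> < \<delta>" "7 / 10 \<le> cos \<omega>" and l: "0 < l" "l < \<delta>"
    and mem: "\<And>c. rect c \<omega> 6 l \<in> homothetic_copies B"
    unfolding thin_rects_def by blast
  let ?u = "vector [cos \<omega>, sin \<omega>] :: real^2" and ?v = "vector [- sin \<omega>, cos \<omega>] :: real^2"
  \<comment> \<open>\<open>s0\<close> is the distance back from \<open>P\<close> to abscissa 3/4.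
    Going 1/2 further moves the abscissa by at most 1/2, so the piece \<open>?S\<close> lies over
    \<open>[1/4, 3/4]\<close> up to an error of 1/100.\<close>
  define s0 where "s0 = (P$1 - 3/4) / cos \<omega>"
  have s0: "s0 * cos \<omega> = P$1 - 3/4" using \<omega> by (simp add: s0_def)
  have "0 \<le> s0" using \<omega> P unfolding s0_def by simp
  have "s0 \<le> (9/4) / (7/10)" unfolding s0_def using P \<omega> by (intro frac_le) auto
  then have s0_le: "s0 \<le> 4" by simp
  let ?R = "rect (P - 6 *\<^sub>R ?u) \<omega> 6 l" and ?S = "rect (P - (s0 + 1/2) *\<^sub>R ?u) \<omega> (1/2) l"
  have sub: "?S \<subseteq> ?R \<inter> U"
  proof
    fix y assume "y \<in> ?S"
    then obtain s t where y: "y = P - (s0 + 1/2) *\<^sub>R ?u + s *\<^sub>R ?u + t *\<^sub>R ?v"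
      and s: "0 \<le> s" "s \<le> 1/2" and t: "0 \<le> t" "t \<le> l" unfolding rect_def by auto
    have "y = (P - 6 *\<^sub>R ?u) + (6 - (s0 + 1/2) + s) *\<^sub>R ?u + t *\<^sub>R ?v"
      unfolding y by (simp add: vec_eq_iff forall_2 algebra_simps)
    moreover have "0 \<le> 6 - (s0 + 1/2) + s" "6 - (s0 + 1/2) + s \<le> 6" using s s0_le \<open>0 \<le> s0\<close> by linarith+
    ultimately have "y \<in> ?R" unfolding rect_def using t by blast
    define \<sigma> where "\<sigma> = s0 + 1/2 - s"
    have \<sigma>: "0 \<le> \<sigma>" "\<sigma> \<le> 6" using s s0_le \<open>0 \<le> s0\<close> by (auto simp: \<sigma>_def)
    have y1: "y$1 = P$1 - \<sigma> * cos \<omega> - t * sin \<omega>" and y2: "y$2 = P$2 - \<sigma> * sin \<omega> + t * cos \<omega>"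
      unfolding y \<sigma>_def by (simp_all add: algebra_simps)
    have "\<bar>t * sin \<omega>\<bar> \<le> \<delta> * 1"
      unfolding abs_mult using t l by (intro mult_mono) auto
    then have tsin: "\<bar>t * sin \<omega>\<bar> \<le> 1/100" using \<delta> by linarith
    have "0 \<le> (1/2 - s) * cos \<omega>" using s \<omega> by simp
    moreover have "(1/2 - s) * cos \<omega> \<le> (1/2) * 1" using s \<omega> by (intro mult_mono) auto
    moreover have "y$1 = 3/4 - (1/2 - s) * cos \<omega> - t * sin \<omega>"
      unfolding y1 \<sigma>_def using s0 by (simp add: algebra_simps)
    ultimately have "0 \<le> y$1" "y$1 \<le> 1" using tsin by linarith+
    moreover have "\<bar>(y$2 - a * y$1) - (P$2 - a * P$1)\<bar> \<le> \<gamma>"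
    proof -
      have "(y$2 - a * y$1) - (P$2 - a * P$1) = t * (cos \<omega> + a * sin \<omega>) - \<sigma> * (sin \<omega> - a * cos \<omega>)"
        unfolding y1 y2 by (simp add: algebra_simps)
      moreover have "\<bar>\<sigma> * (sin \<omega> - a * cos \<omega>)\<bar> \<le> 6 * \<delta>"
        unfolding abs_mult using \<sigma> \<omega> by (intro mult_mono) auto
      moreover have "\<bar>t * (cos \<omega> + a * sin \<omega>)\<bar> \<le> \<delta> * 2"
      proof -
        have "\<bar>a * sin \<omega>\<bar> \<le> 1 * 1" unfolding abs_mult using a by (intro mult_mono) auto
        then have "\<bar>cos \<omega> + a * sin \<omega>\<bar> \<le> 2" using abs_cos_le_one[of \<omega>] by linarith
        then show ?thesis unfolding abs_mult using t l by (intro mult_mono) auto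
      qed
      ultimately show ?thesis using \<delta>(2) by linarith
    qed
    ultimately have "y \<in> strip 0 1 a c d" unfolding strip_def \<gamma>_def by auto
    with U \<open>y \<in> ?R\<close> show "y \<in> ?R \<inter> U" by auto
  qed
  have "P = (P - 6 *\<^sub>R ?u) + 6 *\<^sub>R ?u + 0 *\<^sub>R ?v" by simp
  then have "P \<in> ?R" unfolding rect_def using l by fastforce
  have "ennreal (h * (measure lebesgue ?S / measure lebesgue ?R)) \<le> maximal_op B (\<lambda>y. h * indicator U y) P"
    using l h by (intro maximal_op_indicator_ge mem sub \<open>P \<in> ?R\<close> rect_lmeasurable) (auto simp: measure_rect)
  then show ?thesis using l by (simp add: measure_rect)
qed

section \<open>A Kakeya-type family of strips\<close>

definition digit_slope :: "nat set \<Rightarrow> real" where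
  "digit_slope A = (\<Sum>i\<in>A. (1/2) ^ i)"

text \<open>The shift \<open>i / k\<close> makes the contribution of digit \<open>i\<close> vanish
  at abscissa \<open>i / k\<close>: two lines that differ in this digit alone cross there. The
  crossings are thus spread evenly over \<open>[0, 1]\<close>.\<close>

definition digit_intercept :: "nat \<Rightarrow> nat set \<Rightarrow> real" where
  "digit_intercept k A = - (\<Sum>i\<in>A. (1/2) ^ i * (real i / real k))"

lemma digit_line_eq:
  "digit_slope A * x + digit_intercept k A = (\<Sum>i\<in>A. (1/2) ^ i * (x - real i / real k))"
  by (simp add: digit_slope_def digit_intercept_def right_diff_distrib sum_subtractf sum_distrib_right)

lemma sum_half_powers: "m \<le> k \<Longrightarrow> (\<Sum>i\<in>{m<..k}. (1/2::real) ^ i) = (1/2) ^ m - (1/2) ^ k"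
proof (induction k rule: dec_induct)
  case (step n)
  have "{m<..Suc n} = insert (Suc n) {m<..n}" using step by auto
  then show ?case using step by simp
qed simp

text \<open>The weight \<open>i - m + 1\<close> is \<open>k\<close> times the largest distance from
  \<open>i / k\<close> to a point of \<open>[(m - 1) / k, m / k]\<close>. The sum therefore controls
  the joint contribution of all digits from \<open>m\<close> on over that slab.\<close>

lemma sum_linear_half_powers:
  "m \<le> k \<Longrightarrow> (\<Sum>i\<in>{m..k}. (1/2::real) ^ i * (real i - real m + 1)) = 4 * (1/2) ^ m - (real k - real m + 3) * (1/2) ^ k"
proof (induction k rule: dec_induct)
  case (step n)
  have "{m..Suc n} = insert (Suc n) {m..n}" using step by auto
  then have *: "(\<Sum>i\<in>{m..Suc n}. (1/2::real) ^ i * (real i - real m + 1)) =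
    4 * (1/2) ^ m - (real n - real m + 3) * (1/2) ^ n + (1/2) ^ Suc n * (real (Suc n) - real m + 1)"
    unfolding step.IH[symmetric] by simp
  show ?case unfolding * by (simp add: field_simps)
qed (simp add: algebra_simps)

lemma digit_slope_bounds:
  assumes "A \<subseteq> {1..k}"
  shows "0 \<le> digit_slope A" "digit_slope A \<le> 1"
proof -
  show "0 \<le> digit_slope A" unfolding digit_slope_def by (intro sum_nonneg) auto
  have "digit_slope A \<le> (\<Sum>i\<in>{0<..k}. (1/2) ^ i)" unfolding digit_slope_def
    using assms by (intro sum_mono2) auto
  also have "\<dots> = 1 - (1/2) ^ k" using sum_half_powers[of 0 k] by simp
  also have "\<dots> \<le> 1" by simp
  finally show "digit_slope A \<le> 1" .
qed

text \<open>
  The first differing digit \<open>i\<close> dominates all later ones, since the weights \<open>c\<close> are largest there.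
\<close>

lemma digit_sums_separated_aux:
  fixes c :: "nat \<Rightarrow> real"
  assumes AB: "A \<subseteq> {1..k}" "B \<subseteq> {1..k}" and i: "i \<in> A" "i \<notin> B" "A \<inter> {..<i} = B \<inter> {..<i}"
    and c: "\<And>j. j \<in> {1..k} \<Longrightarrow> 1 \<le> c j" "\<And>j. i < j \<Longrightarrow> j \<le> k \<Longrightarrow> c j \<le> c i"
  shows "(\<Sum>j\<in>B. (1/2) ^ j * c j) + (1/2) ^ k \<le> (\<Sum>j\<in>A. (1/2) ^ j * c j)"
proof -
  have fin: "finite A" "finite B" by (rule finite_subset[OF AB(1)] finite_subset[OF AB(2)], simp)+
  have ik: "i \<in> {1..k}" using AB(1) i(1) by (rule subsetD)
  let ?f = "\<lambda>j. (1/2) ^ j * c j"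
  have f0: "0 \<le> ?f j" if "j \<in> {1..k}" for j using c(1)[OF that] by simp
  \<comment> \<open>At worst \<open>B\<close> contains every digit after \<open>i\<close>; the bound
    for that geometric tail still falls short of digit \<open>i\<close> alone by
    \<open>(1/2) ^ k * c i\<close>.\<close>
  have "B \<subseteq> (B \<inter> {..<i}) \<union> {i<..k}"
  proof
    fix j assume j: "j \<in> B"
    then have "j \<noteq> i" "j \<in> {1..k}" using i(2) AB(2) by blast+
    with j show "j \<in> (B \<inter> {..<i}) \<union> {i<..k}" by auto
  qed
  then have "(\<Sum>j\<in>B. ?f j) \<le> (\<Sum>j\<in>(B \<inter> {..<i}) \<union> {i<..k}. ?f j)"
    using AB(2) fin ik by (intro sum_mono2 f0) auto
  also have "\<dots> = (\<Sum>j\<in>B \<inter> {..<i}. ?f j) + (\<Sum>j\<in>{i<..k}. ?f j)"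
    using fin by (intro sum.union_disjoint) auto
  finally have B_le: "(\<Sum>j\<in>B. ?f j) \<le> (\<Sum>j\<in>B \<inter> {..<i}. ?f j) + (\<Sum>j\<in>{i<..k}. ?f j)" .
  have "(\<Sum>j\<in>{i<..k}. ?f j) \<le> (\<Sum>j\<in>{i<..k}. (1/2) ^ j * c i)"
    using c(2) by (intro sum_mono mult_left_mono) auto
  also have "\<dots> = ((1/2) ^ i - (1/2) ^ k) * c i"
    using ik by (simp add: sum_distrib_right[symmetric] sum_half_powers)
  finally have tail: "(\<Sum>j\<in>{i<..k}. ?f j) \<le> (1/2) ^ i * c i - (1/2) ^ k * c i"
    by (simp add: left_diff_distrib)
  have "?f i + (\<Sum>j\<in>A \<inter> {..<i}. ?f j) = (\<Sum>j\<in>insert i (A \<inter> {..<i}). ?f j)"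
    using fin by (subst sum.insert) auto
  also have "\<dots> \<le> (\<Sum>j\<in>A. ?f j)"
    using fin i(1) AB(1) by (intro sum_mono2 f0) auto
  finally have "(\<Sum>j\<in>B. ?f j) + (1/2) ^ k * c i \<le> (\<Sum>j\<in>A. ?f j)"
    using B_le tail unfolding i(3) by linarith
  moreover have "(1/2) ^ k * 1 \<le> (1/2) ^ k * c i" using c(1)[OF ik] by (intro mult_left_mono) auto
  ultimately show ?thesis by linarith
qed

text \<open>The preceding comparison applies at the least element of the symmetric difference,
  whichever set contains it. The intended weights are \<open>x - j / k\<close> with
  \<open>x \<ge> 2\<close>, which are at least 1 and decrease in \<open>j\<close>.\<close>

lemma digit_sums_separated:
  fixes c :: "nat \<Rightarrow> real"
  assumes "A \<subseteq> {1..k}" "B \<subseteq> {1..k}" "A \<noteq> B"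
    and c: "\<And>j. j \<in> {1..k} \<Longrightarrow> 1 \<le> c j" "\<And>i j. i < j \<Longrightarrow> c j \<le> c i"
  shows "(1/2) ^ k \<le> \<bar>(\<Sum>j\<in>A. (1/2) ^ j * c j) - (\<Sum>j\<in>B. (1/2) ^ j * c j)\<bar>"
proof -
  define D where "D = (A - B) \<union> (B - A)"
  have D: "finite D" "D \<noteq> {}" using assms(1-3) finite_subset[of D "{1..k}"] by (auto simp: D_def)
  define i where "i = Min D"
  have i: "i \<in> D" "\<And>j. j < i \<Longrightarrow> j \<notin> D"
    using Min_in[OF D] Min_le[OF D(1)] unfolding i_def by (auto simp: not_less[symmetric])
  then have eq: "A \<inter> {..<i} = B \<inter> {..<i}" unfolding D_def by auto
  consider "i \<in> A" "i \<notin> B" | "i \<in> B" "i \<notin> A" using i(1) unfolding D_def by auto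
  then show ?thesis
  proof cases
    case 1
    then show ?thesis using digit_sums_separated_aux[OF assms(1,2) 1 eq c] by fastforce
  next
    case 2
    then show ?thesis using digit_sums_separated_aux[OF assms(2,1) 2 eq[symmetric] c] by fastforce
  qed
qed

section \<open>The small set and the large set\<close>

definition digit_strip :: "nat \<Rightarrow> real \<Rightarrow> real \<Rightarrow> real \<Rightarrow> real \<Rightarrow> nat set \<Rightarrow> (real^2) set" where
  "digit_strip k p q c d A = strip p q (digit_slope A) (digit_intercept k A + c) (digit_intercept k A + d)"

lemma mem_digit_strip:
  "x \<in> digit_strip k p q c d A \<longleftrightarrow> p \<le> x$1 \<and> x$1 \<le> q \<and>
     c \<le> x$2 - (\<Sum>i\<in>A. (1/2) ^ i * (x$1 - real i / real k)) \<and> x$2 - (\<Sum>i\<in>A. (1/2) ^ i * (x$1 - real i / real k)) \<le> d"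
  unfolding digit_strip_def strip_def digit_line_eq[symmetric] by auto

lemma digit_strip_measure:
  assumes "p \<le> q" "c \<le> d"
  shows digit_strip_lmeasurable: "digit_strip k p q c d A \<in> lmeasurable"
    and measure_digit_strip: "measure lebesgue (digit_strip k p q c d A) = (q - p) * (d - c)"
  using assms by (simp_all add: digit_strip_def strip_lmeasurable measure_strip)

definition kakeya_core :: "nat \<Rightarrow> (real^2) set" where
  "kakeya_core k = (\<Union>A\<in>Pow {1..k}. digit_strip k 0 1 0 ((1/2) ^ k) A)"

text \<open>Only the middle half of each strip is taken: its points lie strictly inside the full
  strip, leaving room for a thin rectangle, and its thickness is below the separation
  \<open>(1/2) ^ k\<close> of the lines.\<close>

definition kakeya_reach :: "nat \<Rightarrow> (real^2) set" where
  "kakeya_reach k = (\<Union>A\<in>Pow {1..k}. digit_strip k 2 3 ((1/2) ^ k / 4) (3 * (1/2) ^ k / 4) A)"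

lemma kakeya_core_lmeasurable: "kakeya_core k \<in> lmeasurable"
  unfolding kakeya_core_def by (intro fmeasurable.finite_UN digit_strip_lmeasurable) auto

lemma kakeya_reach_lmeasurable: "kakeya_reach k \<in> lmeasurable"
  unfolding kakeya_reach_def by (intro fmeasurable.finite_UN digit_strip_lmeasurable) auto

text \<open>On the slab \<open>(m - 1) / k \<le> x \<le> m / k\<close> the digits from
  \<open>m\<close> on contribute between \<open>- 4 * (1/2) ^ m / k\<close> and 0. Dropping them
  merely lowers the bottom edge of a strip and leaves only \<open>2 ^ (m - 1)\<close> digit
  sets.\<close>

lemma kakeya_core_cover:
  assumes "k > 0"
  shows "kakeya_core k \<subseteq> (\<Union>m\<in>{1..k}. \<Union>A\<in>Pow {1..<m}.
    digit_strip k ((real m - 1) / k) (m / k) (- 4 * (1/2) ^ m / k) ((1/2) ^ k) A)"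
proof
  fix x assume "x \<in> kakeya_core k"
  then obtain A where A: "A \<subseteq> {1..k}" and x: "x \<in> digit_strip k 0 1 0 ((1/2) ^ k) A"
    unfolding kakeya_core_def by auto
  define z where "z = x$1"
  have z: "0 \<le> z" "z \<le> 1" using x by (auto simp: mem_digit_strip z_def)
  \<comment> \<open>This selects the slab containing \<open>z\<close>; the maximum with 1 puts
    \<open>z = 0\<close> into the first slab.\<close>
  define m where "m = max 1 (nat \<lceil>k * z\<rceil>)"
  have "k * z \<le> real k * 1" using z by (intro mult_left_mono) auto
  then have mk: "m \<in> {1..k}" using assms by (auto simp: m_def nat_le_iff ceiling_le_iff)
  have "real m - 1 \<le> k * z" "k * z \<le> real m"
    using z unfolding m_def max_def by (auto simp: of_nat_nat; linarith)+
  then have mz: "(real m - 1) / k \<le> z" "z \<le> m / k" using assms by (auto simp: field_simps)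
  define A1 where "A1 = A \<inter> {1..<m}"
  define A2 where "A2 = A \<inter> {m..k}"
  have fin: "finite A1" "finite A2" by (auto simp: A1_def A2_def)
  let ?f = "\<lambda>i. (1/2) ^ i * (z - real i / real k)"
  have "A = A1 \<union> A2" "A1 \<inter> A2 = {}" using A mk by (auto simp: A1_def A2_def)
  then have split: "(\<Sum>i\<in>A. ?f i) = (\<Sum>i\<in>A1. ?f i) + (\<Sum>i\<in>A2. ?f i)"
    using fin by (simp add: sum.union_disjoint)
  have up: "(\<Sum>i\<in>A2. ?f i) \<le> 0"
  proof (intro sum_nonpos mult_nonneg_nonpos)
    fix i assume "i \<in> A2"
    then have "real m / k \<le> real i / k" by (intro divide_right_mono) (auto simp: A2_def)
    then show "z - real i / k \<le> 0" using mz by linarith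
  qed auto
  have "- (\<Sum>i\<in>A2. ?f i) = (\<Sum>i\<in>A2. (1/2) ^ i * (real i / k - z))"
    by (simp add: sum_negf[symmetric] algebra_simps)
  also have "\<dots> \<le> (\<Sum>i\<in>A2. (1/2) ^ i * ((real i - real m + 1) / k))"
  proof (intro sum_mono mult_left_mono)
    fix i assume "i \<in> A2"
    have "real i / k - z \<le> real i / k - (real m - 1) / k" using mz by linarith
    also have "\<dots> = (real i - real m + 1) / k" by (simp add: diff_divide_distrib[symmetric])
    finally show "real i / k - z \<le> (real i - real m + 1) / k" .
  qed auto
  also have "\<dots> \<le> (\<Sum>i\<in>{m..k}. (1/2) ^ i * ((real i - real m + 1) / k))"
    by (intro sum_mono2) (auto simp: A2_def)
  also have "\<dots> = (\<Sum>i\<in>{m..k}. (1/2) ^ i * (real i - real m + 1)) / k"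
    by (simp add: sum_divide_distrib)
  also have "\<dots> \<le> 4 * (1/2) ^ m / k"
    using mk by (intro divide_right_mono) (auto simp: sum_linear_half_powers)
  finally have low: "- (4 * (1/2) ^ m / k) \<le> (\<Sum>i\<in>A2. ?f i)" by linarith
  have "x \<in> digit_strip k ((real m - 1) / k) (m / k) (- 4 * (1/2) ^ m / k) ((1/2) ^ k) A1"
    using x mz split up low unfolding mem_digit_strip z_def[symmetric] by auto
  moreover have "A1 \<in> Pow {1..<m}" by (auto simp: A1_def)
  ultimately show "x \<in> (\<Union>m\<in>{1..k}. \<Union>A\<in>Pow {1..<m}.
    digit_strip k ((real m - 1) / k) (m / k) (- 4 * (1/2) ^ m / k) ((1/2) ^ k) A)" using mk by blast
qed

text \<open>Slab \<open>m\<close> is covered by \<open>2 ^ (m - 1)\<close> strips of width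
  \<open>1 / k\<close>. The thickness \<open>4 * (1/2) ^ m / k\<close> costs
  \<open>2 / k\<^sup>2\<close> per slab, hence \<open>2 / k\<close> in total, and the thickness
  \<open>(1/2) ^ k\<close> adds a geometric series of at most \<open>1 / k\<close>.\<close>

lemma measure_kakeya_core_le:
  assumes "k > 0"
  shows "measure lebesgue (kakeya_core k) \<le> 3 / k"
proof -
  let ?S = "\<lambda>m A. digit_strip k ((real m - 1) / k) (m / k) (- 4 * (1/2) ^ m / k) ((1/2) ^ k) A"
  have le: "(real m - 1) / k \<le> m / k" "- 4 * (1/2) ^ m / k \<le> (1/2) ^ k" for m
  proof -
    show "(real m - 1) / k \<le> m / k" by (intro divide_right_mono) auto
    have "- 4 * (1/2) ^ m / k \<le> 0" "0 \<le> (1/2::real) ^ k" by (simp_all add: divide_nonpos_nonneg)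
    then show "- 4 * (1/2) ^ m / k \<le> (1/2) ^ k" by linarith
  qed
  have S: "?S m A \<in> lmeasurable" for m A by (intro digit_strip_lmeasurable le)
  have area: "measure lebesgue (?S m A) = (1 / k) * ((1/2) ^ k + 4 * (1/2) ^ m / k)" for m A
    using le by (subst measure_digit_strip) (auto simp: diff_divide_distrib[symmetric])
  have pow: "real (2 ^ (m - 1)) * (1/2) ^ m = 1/2" if "m \<ge> 1" for m
    using that by (cases m) (auto simp: power_divide)
  have pow': "real (2 ^ (m - 1)) * (1/2) ^ k \<le> (1/2) ^ (k - m) / 2" if "m \<in> {1..k}" for m
  proof -
    have "(1/2::real) ^ k = (1/2) ^ (k - m) * (1/2) ^ m" using that by (simp add: power_add[symmetric])
    then have "real (2 ^ (m - 1)) * (1/2) ^ k = (real (2 ^ (m - 1)) * (1/2) ^ m) * (1/2) ^ (k - m)"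
      by (simp only: mult_ac)
    then show ?thesis using pow[of m] that by simp
  qed
  have T: "(\<Union>A\<in>Pow {1..<m}. ?S m A) \<in> lmeasurable" for m
    by (intro fmeasurable.finite_UN S) auto
  have T': "(\<Union>m\<in>{1..k}. \<Union>A\<in>Pow {1..<m}. ?S m A) \<in> lmeasurable"
    by (intro fmeasurable.finite_UN[OF _ T]) auto
  have "measure lebesgue (kakeya_core k) \<le> measure lebesgue (\<Union>m\<in>{1..k}. \<Union>A\<in>Pow {1..<m}. ?S m A)"
    using kakeya_core_cover[OF assms] fmeasurableD[OF kakeya_core_lmeasurable] T'
    by (rule measure_mono_fmeasurable)
  also have "\<dots> \<le> (\<Sum>m\<in>{1..k}. measure lebesgue (\<Union>A\<in>Pow {1..<m}. ?S m A))"
    by (rule measure_UNION_le[OF _ fmeasurableD[OF T]]) simp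
  also have "\<dots> \<le> (\<Sum>m\<in>{1..k}. \<Sum>A\<in>Pow {1..<m}. measure lebesgue (?S m A))"
    by (rule sum_mono, rule measure_UNION_le[OF _ fmeasurableD[OF S]]) simp
  also have "\<dots> = (\<Sum>m\<in>{1..k}. real (2 ^ (m - 1)) * ((1 / k) * ((1/2) ^ k + 4 * (1/2) ^ m / k)))"
    unfolding area by (simp add: card_Pow)
  also have "\<dots> = (\<Sum>m\<in>{1..k}. (1 / k) * (real (2 ^ (m - 1)) * (1/2) ^ k) + (4 / k\<^sup>2) * (real (2 ^ (m - 1)) * (1/2) ^ m))"
    by (intro sum.cong) (simp_all add: algebra_simps power2_eq_square)
  also have "\<dots> \<le> (\<Sum>m\<in>{1..k}. (1 / k) * ((1/2) ^ (k - m) / 2) + (4 / k\<^sup>2) * (1/2))"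
    using pow pow' by (intro sum_mono add_mono mult_left_mono) auto
  also have "\<dots> = (1 / k) * (\<Sum>m\<in>{1..k}. (1/2) ^ (k - m)) / 2 + 2 / k"
    using assms by (simp add: sum.distrib sum_distrib_left sum_divide_distrib power2_eq_square)
  also have "\<dots> \<le> (1 / k) * 2 / 2 + 2 / k"
  proof -
    have "(\<Sum>m\<in>{1..k}. (1/2::real) ^ (k - m)) = (\<Sum>j\<in>{..<k}. (1/2) ^ j)"
      by (rule sum.reindex_bij_witness[of _ "\<lambda>j. k - j" "\<lambda>m. k - m"]) auto
    also have "\<dots> \<le> 2" by (simp add: sum_gp_strict)
    finally show ?thesis by (intro add_right_mono divide_right_mono mult_left_mono) auto
  qed
  finally show ?thesis by simp
qed

lemma measure_kakeya_core_pos: "0 < measure lebesgue (kakeya_core k)"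
proof -
  have "measure lebesgue (digit_strip k 0 1 0 ((1/2) ^ k) {}) \<le> measure lebesgue (kakeya_core k)"
    by (intro measure_mono_fmeasurable kakeya_core_lmeasurable fmeasurableD digit_strip_lmeasurable)
      (auto simp: kakeya_core_def)
  then show ?thesis by (simp add: measure_digit_strip) (metis less_le_trans zero_less_power zero_less_divide_1_iff zero_less_numeral power_one_over)
qed

text \<open>To the right of abscissa 2 every weight \<open>x - j / k\<close> is at least 1, so lines
  of distinct digit sets are at least \<open>(1/2) ^ k\<close> apart, which exceeds the
  thickness.\<close>

lemma digit_strips_disjoint:
  assumes "k > 0" "A \<subseteq> {1..k}" "B \<subseteq> {1..k}" "A \<noteq> B" "2 \<le> p" "d - c < (1/2) ^ k"
  shows "digit_strip k p q c d A \<inter> digit_strip k p q c d B = {}"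
proof -
  have False if x: "x \<in> digit_strip k p q c d A" "x \<in> digit_strip k p q c d B" for x
  proof -
    let ?g = "\<lambda>A. (\<Sum>i\<in>A. (1/2) ^ i * (x$1 - real i / real k))"
    have "(1/2) ^ k \<le> \<bar>?g A - ?g B\<bar>"
    proof (rule digit_sums_separated[OF assms(2-4)])
      fix j assume "j \<in> {1..k}"
      then have "real j / k \<le> 1" by simp
      moreover have "2 \<le> x$1" using x(1) assms(5) unfolding mem_digit_strip by linarith
      ultimately show "1 \<le> x$1 - real j / k" by linarith
    qed (auto intro: divide_right_mono)
    then show False using x assms(6) unfolding mem_digit_strip by linarith
  qed
  then show ?thesis by blast
qed

lemma measure_kakeya_reach:
  assumes "k > 0"
  shows "measure lebesgue (kakeya_reach k) = 1 / 2"
proof -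
  let ?S = "digit_strip k 2 3 ((1/2) ^ k / 4) (3 * (1/2) ^ k / 4)"
  have "measure lebesgue (kakeya_reach k) = (\<Sum>A\<in>Pow {1..k}. measure lebesgue (?S A))"
    unfolding kakeya_reach_def
  proof (rule measure_UNION')
    show "pairwise (\<lambda>A B. disjnt (?S A) (?S B)) (Pow {1..k})"
      unfolding pairwise_def disjnt_def using assms by (intro ballI impI digit_strips_disjoint) auto
  qed (auto intro: digit_strip_lmeasurable)
  also have "\<dots> = 2 ^ k * ((1/2) ^ k / 2)"
    by (simp add: measure_digit_strip card_Pow)
  also have "\<dots> = 1 / 2" by (simp add: power_divide)
  finally show ?thesis .
qed

text \<open>A point of the large set lies strictly within the full-width strip of the same digits,
  whose part over \<open>[0, 1]\<close> belongs to the small set.\<close>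

lemma maximal_op_kakeya_reach_ge:
  assumes "thin_rects B" "x \<in> kakeya_reach k" "0 \<le> h"
  shows "ennreal (h * (1/12)) \<le> maximal_op B (\<lambda>y. h * indicator (kakeya_core k) y) x"
proof -
  obtain A where A: "A \<subseteq> {1..k}" and x: "x \<in> digit_strip k 2 3 ((1/2) ^ k / 4) (3 * (1/2) ^ k / 4) A"
    using assms(2) unfolding kakeya_reach_def by auto
  define w :: real where "w = (1/2) ^ k"
  have w: "w > 0" by (simp add: w_def)
  have P: "2 \<le> x$1" "x$1 \<le> 3" "digit_intercept k A < x$2 - digit_slope A * x$1"
    "x$2 - digit_slope A * x$1 < digit_intercept k A + w"
    using x w unfolding w_def[symmetric] digit_strip_def strip_def by auto
  show ?thesis
  proof (rule maximal_op_strip_ge[OF assms(1) digit_slope_bounds[OF A] P])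
    show "strip 0 1 (digit_slope A) (digit_intercept k A) (digit_intercept k A + w) \<subseteq> kakeya_core k"
      using A unfolding kakeya_core_def digit_strip_def w_def by auto
  qed (rule assms(3))
qed

section \<open>From Kakeya-type sets to unboundedness\<close>

lemma ennpowr_ennreal: "0 \<le> a \<Longrightarrow> ennpowr (ennreal a) q = ennreal (a powr q)"
  by (simp add: ennpowr_def)

lemma ennpowr_mono:
  assumes "a \<le> b" "0 \<le> q"
  shows "ennpowr a q \<le> ennpowr b q"
proof (cases "b = \<infinity>")
  case False
  then have "enn2real a \<le> enn2real b" using assms by (intro enn2real_mono) (auto simp: top.not_eq_extremum)
  moreover have "a \<noteq> \<infinity>" using False assms(1) by (metis infinity_ennreal_def neq_top_trans)
  ultimately show ?thesis using False assms(2)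
    by (auto simp: ennpowr_def intro!: ennreal_leI powr_mono2)
qed (simp add: ennpowr_def)

lemma Lp_norm_cmult_indicator:
  assumes "U \<in> lmeasurable" "0 < p" "0 \<le> h"
  shows "Lp_norm p (\<lambda>x. ennreal \<bar>h * indicator U x\<bar>) = ennreal (h * measure lebesgue U powr (1 / p))"
proof -
  have "(\<integral>\<^sup>+x. ennpowr (ennreal \<bar>h * indicator U x\<bar>) p \<partial>lebesgue) = (\<integral>\<^sup>+x. ennreal (h powr p) * indicator U x \<partial>lebesgue)"
    using assms by (intro nn_integral_cong) (auto simp: ennpowr_ennreal indicator_def)
  also have "\<dots> = ennreal (h powr p * measure lebesgue U)"
    using assms by (simp add: nn_integral_cmult_indicator fmeasurableD emeasure_eq_measure2 ennreal_mult)
  finally show ?thesis using assms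
    by (simp add: Lp_norm_def ennpowr_ennreal powr_mult powr_powr)
qed

text \<open>Chebyshev's inequality in norm form, by pointwise comparison with
  \<open>h * indicator V\<close>.\<close>

lemma Lp_norm_ge:
  assumes "V \<in> lmeasurable" "0 < p" "0 \<le> h" "\<And>x. x \<in> V \<Longrightarrow> ennreal h \<le> g x"
  shows "ennreal (h * measure lebesgue V powr (1 / p)) \<le> Lp_norm p g"
proof -
  have "ennreal \<bar>h * indicator V x\<bar> \<le> g x" for x
    using assms(3,4) by (auto simp: indicator_def)
  then have "Lp_norm p (\<lambda>x. ennreal \<bar>h * indicator V x\<bar>) \<le> Lp_norm p g"
    unfolding Lp_norm_def using assms(2) by (intro ennpowr_mono nn_integral_mono) auto
  then show ?thesis using Lp_norm_cmult_indicator[OF assms(1-3)] by simp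
qed

text \<open>For the indicator of \<open>U\<close> normalised in \<open>L^p\<close>, the maximal
  function is at least \<open>c / |U| powr (1/p)\<close> on \<open>V\<close>. Its norm is then at
  least \<open>c * (|V| / |U|) powr (1/p)\<close>, which is unbounded as \<open>\<epsilon>\<close>
  tends to 0.\<close>

lemma bad_operatorI:
  assumes "0 < c"
    and "\<And>\<epsilon>. 0 < \<epsilon> \<Longrightarrow> \<exists>U V. U \<in> lmeasurable \<and> V \<in> lmeasurable \<and> 0 < measure lebesgue U \<and>
      measure lebesgue U \<le> \<epsilon> * measure lebesgue V \<and>
      (\<forall>x\<in>V. \<forall>h\<ge>0. ennreal (h * c) \<le> maximal_op B (\<lambda>y. h * indicator U y) x)"
  shows "bad_operator B"
  unfolding bad_operator_def
proof (intro allI impI notI)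
  fix p :: real assume p: "1 < p" and "bounded_on_Lp B p"
  then have fin: "maximal_op_norm B p < \<infinity>" by (simp add: bounded_on_Lp_def)
  define C where "C = enn2real (maximal_op_norm B p)"
  have C: "0 \<le> C" "maximal_op_norm B p = ennreal C" using fin by (auto simp: C_def)
  \<comment> \<open>Chosen so that \<open>\<epsilon> powr (1/p) = c / (C + 1)\<close>; the lower
    bound for the norm then becomes \<open>C + 1\<close>.\<close>
  define \<epsilon> where "\<epsilon> = (c / (C + 1)) powr p"
  have "0 < \<epsilon>" using assms(1) C(1) by (simp add: \<epsilon>_def)
  from assms(2)[OF this] obtain U V where U: "U \<in> lmeasurable" "0 < measure lebesgue U"
    and V: "V \<in> lmeasurable" and le: "measure lebesgue U \<le> \<epsilon> * measure lebesgue V"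
    and M: "\<And>x h. x \<in> V \<Longrightarrow> 0 \<le> h \<Longrightarrow> ennreal (h * c) \<le> maximal_op B (\<lambda>y. h * indicator U y) x"
    by blast
  define u v h where "u = measure lebesgue U powr (1 / p)" and "v = measure lebesgue V powr (1 / p)" and "h = 1 / u"
  have u: "0 < u" using U by (simp add: u_def)
  then have h: "0 < h" "h * u = 1" by (simp_all add: h_def)
  have "u \<le> (\<epsilon> * measure lebesgue V) powr (1 / p)"
    unfolding u_def using le p by (intro powr_mono2) auto
  also have "\<dots> = c / (C + 1) * v"
    using assms(1) C(1) p by (simp add: \<epsilon>_def v_def powr_mult powr_powr)
  finally have "h * u \<le> h * (c / (C + 1) * v)" using h by (intro mult_left_mono) auto
  then have *: "C + 1 \<le> h * c * v" using h C(1) by (simp add: field_simps)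
  let ?f = "\<lambda>y. h * indicator U y :: real"
  have "Lp_norm p (\<lambda>x. ennreal \<bar>?f x\<bar>) = 1"
    using Lp_norm_cmult_indicator[OF U(1), of p h] p h by (simp add: u_def)
  moreover have "?f \<in> borel_measurable lebesgue"
    using U(1) by (intro borel_measurable_times borel_measurable_const borel_measurable_indicator fmeasurableD)
  ultimately have "Lp_norm p (maximal_op B ?f) \<le> maximal_op_norm B p"
    unfolding maximal_op_norm_def by (intro SUP_upper) auto
  moreover have "ennreal (h * c * v) \<le> Lp_norm p (maximal_op B ?f)"
    unfolding v_def using V p h assms(1) M by (intro Lp_norm_ge) auto
  ultimately have "ennreal (h * c * v) \<le> ennreal C" unfolding C(2) by (rule order_trans[rotated])
  then have "h * c * v \<le> C" using C(1) by simp
  with * show False by simp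
qed

lemma bad_operator_thin_rects:
  assumes "thin_rects B"
  shows "bad_operator B"
proof (rule bad_operatorI[of "1/12"])
  fix \<epsilon> :: real assume "0 < \<epsilon>"
  \<comment> \<open>The threshold balances the area bound \<open>3 / k\<close> of the small set
    against the area 1/2 of the large one.\<close>
  obtain k :: nat where k: "6 / \<epsilon> < k" using reals_Archimedean2 by blast
  have "0 < 6 / \<epsilon>" using \<open>0 < \<epsilon>\<close> by simp
  then have "k > 0" using k by (cases k) auto
  have "3 / k \<le> \<epsilon> * (1 / 2)" using k \<open>0 < \<epsilon>\<close> \<open>k > 0\<close> by (simp add: field_simps)
  then have "measure lebesgue (kakeya_core k) \<le> \<epsilon> * measure lebesgue (kakeya_reach k)"
    unfolding measure_kakeya_reach[OF \<open>k > 0\<close>] using measure_kakeya_core_le[OF \<open>k > 0\<close>] by linarith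
  then show "\<exists>U V. U \<in> lmeasurable \<and> V \<in> lmeasurable \<and> 0 < measure lebesgue U \<and>
      measure lebesgue U \<le> \<epsilon> * measure lebesgue V \<and>
      (\<forall>x\<in>V. \<forall>h\<ge>0. ennreal (h * (1/12)) \<le> maximal_op B (\<lambda>y. h * indicator U y) x)"
    by (intro exI[of _ "kakeya_core k"] exI[of _ "kakeya_reach k"] conjI ballI allI impI kakeya_core_lmeasurable
        kakeya_reach_lmeasurable measure_kakeya_core_pos maximal_op_kakeya_reach_ge[OF assms])
qed simp

section \<open>Thin rectangles in the given family\<close>

lemma cos_ge_of_abs_le_pi_4:
  assumes "\<bar>x\<bar> \<le> pi / 4"
  shows "7 / 10 \<le> cos x"
proof -
  have "(7 / 5)\<^sup>2 \<le> (2::real)" by (simp add: power2_eq_square)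
  then have "7 / 5 \<le> sqrt 2" by (rule real_le_rsqrt)
  then have "7 / 10 \<le> cos (pi / 4)" by (simp add: cos_45)
  also have "\<dots> \<le> cos \<bar>x\<bar>" using assms by (intro cos_monotone_0_pi_le) auto
  finally show ?thesis by simp
qed

theorem theorem7:
  fixes r :: "nat \<Rightarrow> (real^2) set"
  assumes "\<And>n. n \<ge> 1 \<Longrightarrow> rectangle (r n)"
    and "\<And>n. n \<ge> 1 \<Longrightarrow> has_eccentricity (r n) (1 / real n)"
    and "\<And>n. n \<ge> 1 \<Longrightarrow> has_orientation (r n) (sin (real n) * (pi / 4))"
  shows "bad_operator {r n | n. n \<ge> 1}"
proof (rule bad_operator_thin_rects, unfold thin_rects_def, intro allI impI)
  fix a \<delta> :: real assume a: "0 \<le> a" "a \<le> 1" and \<delta>: "0 < \<delta>"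
  \<comment> \<open>\<open>\<alpha>\<close> is the angle of slope \<open>a\<close>. As
    \<open>a\<close> lies in \<open>[0, 1]\<close>, the quotient of \<open>\<alpha>\<close> by
    \<open>pi / 4\<close> lies in \<open>[0, 1]\<close>, so it can be approximated by sines of
    integers.\<close>
  define \<alpha> where "\<alpha> = arctan a"
  have "arctan 0 \<le> \<alpha>" "\<alpha> \<le> arctan 1" unfolding \<alpha>_def using a by (simp_all only: arctan_le_iff)
  then have \<alpha>: "0 \<le> \<alpha>" "\<alpha> \<le> pi / 4" by (simp_all add: arctan_one)
  \<comment> \<open>Here \<open>24 = 6 * 4\<close>: the long side is scaled to 6, and comparing the
    two parametrisations costs a factor 4.\<close>
  obtain N :: nat where N: "24 / \<delta> < N" using reals_Archimedean2 by blast
  have "\<bar>\<alpha> / (pi / 4)\<bar> \<le> 1" using \<alpha> by (simp add: abs_le_iff)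
  then obtain n where n: "n \<ge> max N 1" "\<bar>sin (real n) - \<alpha> / (pi / 4)\<bar> < \<delta> / 2"
    using \<delta> sin_nat_dense[of "\<alpha> / (pi / 4)" "\<delta> / 2" "max N 1"] by auto
  define \<omega> where "\<omega> = sin (real n) * (pi / 4)"
  have "24 / \<delta> < n" using N n(1) by linarith
  then have n\<delta>: "24 / n < \<delta>" using \<delta> n(1) by (simp add: field_simps)
  have "\<bar>\<omega>\<bar> \<le> 1 * (pi / 4)" unfolding \<omega>_def abs_mult by (intro mult_mono) auto
  then have cos\<omega>: "7 / 10 \<le> cos \<omega>" by (intro cos_ge_of_abs_le_pi_4) simp
  have "\<omega> - \<alpha> = (sin (real n) - \<alpha> / (pi / 4)) * (pi / 4)"
    by (simp add: \<omega>_def left_diff_distrib)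
  then have "\<bar>\<omega> - \<alpha>\<bar> = \<bar>sin (real n) - \<alpha> / (pi / 4)\<bar> * (pi / 4)"
    by (simp only: abs_mult) simp
  also have "\<dots> \<le> \<delta> / 2 * 1" using n(2) \<delta> pi_less_4 by (intro mult_mono) auto
  finally have dist: "\<bar>\<omega> - \<alpha>\<bar> \<le> \<delta> / 2" by simp
  have cos\<alpha>: "7 / 10 \<le> cos \<alpha>" using \<alpha> by (intro cos_ge_of_abs_le_pi_4) simp
  \<comment> \<open>The identity \<open>cos \<alpha> * (sin \<omega> - a * cos \<omega>) = sin
    (\<omega> - \<alpha>)\<close> turns closeness of angles into the slope condition. The loss from
    dividing by \<open>cos \<alpha> \<ge> 7/10\<close> is covered by the spare factor in
    \<open>\<delta> / 2\<close>.\<close>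
  have "a = tan \<alpha>" by (simp add: \<alpha>_def tan_arctan)
  then have "a = sin \<alpha> / cos \<alpha>" unfolding tan_def .
  then have "cos \<alpha> * (sin \<omega> - a * cos \<omega>) = sin (\<omega> - \<alpha>)"
    using cos\<alpha> by (simp add: sin_diff field_simps)
  then have "\<bar>cos \<alpha>\<bar> * \<bar>sin \<omega> - a * cos \<omega>\<bar> = \<bar>sin (\<omega> - \<alpha>)\<bar>"
    unfolding abs_mult[symmetric] by simp
  then have "cos \<alpha> * \<bar>sin \<omega> - a * cos \<omega>\<bar> = \<bar>sin (\<omega> - \<alpha>)\<bar>"
    using cos\<alpha> by simp
  moreover have "\<bar>sin (\<omega> - \<alpha>)\<bar> \<le> \<delta> / 2" using abs_sin_x_le_abs_x[of "\<omega> - \<alpha>"] dist by linarith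
  moreover have "7 / 10 * \<bar>sin \<omega> - a * cos \<omega>\<bar> \<le> cos \<alpha> * \<bar>sin \<omega> - a * cos \<omega>\<bar>"
    using cos\<alpha> by (intro mult_right_mono) auto
  moreover have "x < \<delta>" if "7 / 10 * x \<le> y" "y = z" "z \<le> \<delta> / 2" for x y z using that \<delta> by linarith
  ultimately have slope: "\<bar>sin \<omega> - a * cos \<omega>\<bar> < \<delta>" by blast
  have n1: "n \<ge> 1" using n(1) by simp
  from assms(3)[OF n1] obtain c L l where R: "0 < l" "l \<le> L" "r n = rect c \<omega> L l"
    unfolding \<omega>_def[symmetric] by (rule has_orientation_rect)
  from assms(2)[OF n1] obtain c' \<theta>' L' l' where R': "0 < l'" "l' \<le> L'" "r n = rect c' \<theta>' L' l'" "1 / real n = l' / L'"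
    unfolding has_eccentricity_def by auto
  have "l / L \<le> 4 * (l' / L')"
    by (rule rect_eq_imp_eccentricity_le[of c' \<theta>' L' l' c \<omega> L l]) (use R R' in auto)
  then have "6 * (l / L) \<le> 24 / n" using R'(4) by simp
  with n\<delta> have "6 * (l / L) < \<delta>" by linarith
  moreover have "0 < 6 * (l / L)" using R by simp
  moreover have "rect b \<omega> 6 (6 * (l / L)) \<in> homothetic_copies {r n | n. n \<ge> 1}" for b
    using R n1 by (intro rect_homothetic_copies[of c]) auto
  ultimately show "\<exists>\<omega> l. \<bar>sin \<omega> - a * cos \<omega>\<bar> < \<delta> \<and> 7 / 10 \<le> cos \<omega> \<and> 0 < l \<and> l < \<delta> \<and>
       (\<forall>c. rect c \<omega> 6 l \<in> homothetic_copies {r n | n. n \<ge> 1})"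
    using slope cos\<omega> by blast
qed

end
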